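(* Suppose $1\rightarrow N\rightarrow G\rightarrow Q\rightarrow 1$ is a short exact sequence of groups and $N$ is finitely generated. If $G$ is strongly periodic, then $Q$ is strongly periodic.
   Context: Let $G$ be a group and $A$ a finite discrete set (an alphabet). The full shift $A^G$ is the set of all functions $G\to A$ (called configurations), with the product topology and the left $G$-action $(gx)(h)=x(g^{-1}h)$. A pattern is a function $p:\Omega\to A$ with $\Omega\subset G$ finite; it appears in $x\in A^G$ if $(gx)|_\Omega=p$ for some $g\in G$. A shift of finite type (SFT) over $G$ is a nonempty set of the form $S=\{x\in A^G:\text{ no } p\in P \text{ appears in } x\}$ for some finite alphabet $A$ and some finite set $P$ of patterns (SFTs are nonempty by convention). For $x\in A^G$ let $\mathrm{Stab}_G(x)=\{g\in G: gx=x\}$. A configuration $x$ is strongly periodic if $\mathrm{Stab}_G(x)$ has finite index in $G$. The group $G$ is strongly periodic if every SFT over $G$ (for every finite alphabet) contains a strongly periodic configuration. *)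

theory Defs
  imports "HOL-Algebra.Algebra"
begin

definition full_shift :: "('g, 'm) monoid_scheme \<Rightarrow> 'a set \<Rightarrow> ('g \<Rightarrow> 'a) set" where
  "full_shift G A = carrier G \<rightarrow>\<^sub>E A"

text \<open>The outer restriction makes each translation an element of the library group
  \<^const>\<open>BijGroup\<close> over the full shift; see \<open>group_action_shift\<close> below.\<close>

definition shift_action ::
    "('g, 'm) monoid_scheme \<Rightarrow> 'a set \<Rightarrow> 'g \<Rightarrow> ('g \<Rightarrow> 'a) \<Rightarrow> ('g \<Rightarrow> 'a)" where
  "shift_action G A g =
     (\<lambda>x \<in> full_shift G A. \<lambda>h \<in> carrier G. x (inv\<^bsub>G\<^esub> g \<otimes>\<^bsub>G\<^esub> h))"

text \<open>A pattern is a finite support together with an extensional function on it.\<close>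

definition patterns :: "('g, 'm) monoid_scheme \<Rightarrow> 'a set \<Rightarrow> ('g set \<times> ('g \<Rightarrow> 'a)) set" where
  "patterns G A = (SIGMA \<Omega>:{\<Omega>. \<Omega> \<subseteq> carrier G \<and> finite \<Omega>}. \<Omega> \<rightarrow>\<^sub>E A)"

definition appears_in ::
    "('g, 'm) monoid_scheme \<Rightarrow> 'a set \<Rightarrow> ('g set \<times> ('g \<Rightarrow> 'a)) \<Rightarrow> ('g \<Rightarrow> 'a) \<Rightarrow> bool" where
  "appears_in G A p x \<longleftrightarrow>
     (\<exists>g \<in> carrier G. restrict (shift_action G A g x) (fst p) = snd p)"

definition is_SFT :: "('g, 'm) monoid_scheme \<Rightarrow> 'a set \<Rightarrow> ('g \<Rightarrow> 'a) set \<Rightarrow> bool" where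
  "is_SFT G A S \<longleftrightarrow> finite A \<and> S \<noteq> {} \<and>
     (\<exists>P. finite P \<and> P \<subseteq> patterns G A \<and>
          S = {x \<in> full_shift G A. \<forall>p \<in> P. \<not> appears_in G A p x})"

definition strongly_periodic_config ::
    "('g, 'm) monoid_scheme \<Rightarrow> 'a set \<Rightarrow> ('g \<Rightarrow> 'a) \<Rightarrow> bool" where
  "strongly_periodic_config G A x \<longleftrightarrow>
     finite (rcosets\<^bsub>G\<^esub> (stabilizer G (shift_action G A) x))"

text \<open>HOL cannot quantify over the type of alphabet symbols inside a definition, so alphabets
  range over the finite sets of natural numbers. Nothing is lost: \<open>strongly_periodicD\<close> below
  transfers the property to finite alphabets of any type.\<close>

definition strongly_periodic :: "('g, 'm) monoid_scheme \<Rightarrow> bool" where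
  "strongly_periodic G \<longleftrightarrow>
     (\<forall>(A :: nat set) S. is_SFT G A S \<longrightarrow> (\<exists>x \<in> S. strongly_periodic_config G A x))"

definition finitely_generated_group :: "('g, 'm) monoid_scheme \<Rightarrow> bool" where
  "finitely_generated_group G \<longleftrightarrow>
     (\<exists>T. finite T \<and> T \<subseteq> carrier G \<and> generate G T = carrier G)"

context group
begin

lemma shift_action_closed:
  assumes "g \<in> carrier G" "x \<in> full_shift G A"
  shows "shift_action G A g x \<in> full_shift G A"
  using assms by (auto simp: shift_action_def full_shift_def)

lemma shift_action_apply:
  assumes "x \<in> full_shift G A" "h \<in> carrier G"
  shows "shift_action G A g x h = x (inv g \<otimes> h)"
  using assms by (simp add: shift_action_def)

lemma full_shift_eqI:
  assumes "x \<in> full_shift G A" "y \<in> full_shift G A" "\<And>h. h \<in> carrier G \<Longrightarrow> x h = y h"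
  shows "x = y"
  using assms unfolding full_shift_def by (rule PiE_ext)

lemma shift_action_mult:
  assumes "g \<in> carrier G" "k \<in> carrier G" "x \<in> full_shift G A"
  shows "shift_action G A (g \<otimes> k) x = shift_action G A g (shift_action G A k x)"
  by (rule full_shift_eqI[where A = A])
     (use assms in \<open>auto simp: shift_action_closed shift_action_apply inv_mult_group m_assoc\<close>)

lemma shift_action_one:
  assumes "x \<in> full_shift G A"
  shows "shift_action G A \<one> x = x"
  by (rule full_shift_eqI[where A = A])
     (use assms in \<open>auto simp: shift_action_closed shift_action_apply\<close>)

lemma shift_action_Bij:
  assumes "g \<in> carrier G"
  shows "shift_action G A g \<in> Bij (full_shift G A)"
proof -
  have "bij_betw (shift_action G A g) (full_shift G A) (full_shift G A)"
    by (rule bij_betw_byWitness[where f' = "shift_action G A (inv g)"])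
       (use assms in \<open>auto simp: shift_action_closed shift_action_one
          simp flip: shift_action_mult\<close>)
  then show ?thesis
    by (simp add: Bij_def shift_action_def)
qed

lemma group_action_shift: "group_action G (full_shift G A) (shift_action G A)"
proof -
  have "shift_action G A (g \<otimes> k) =
      compose (full_shift G A) (shift_action G A g) (shift_action G A k)"
    if "g \<in> carrier G" "k \<in> carrier G" for g k
  proof (rule extensionalityI[where A = "full_shift G A"])
    show "shift_action G A (g \<otimes> k) \<in> extensional (full_shift G A)"
      by (simp add: shift_action_def)
  qed (use that in \<open>simp_all add: compose_eq shift_action_mult\<close>)
  then have "shift_action G A \<in> hom G (BijGroup (full_shift G A))"
    by (auto simp: hom_def BijGroup_def shift_action_Bij)
  then show ?thesis
    by (simp add: group_action_def group_hom_def group_hom_axioms_def is_group group_BijGroup)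
qed

lemma strongly_periodicD:
  fixes A :: "'c set"
  assumes G: "strongly_periodic G" and S: "is_SFT G A S"
  shows "\<exists>x \<in> S. strongly_periodic_config G A x"
proof -
  obtain P where P: "finite P" "P \<subseteq> patterns G A"
      and S_eq: "S = {x \<in> full_shift G A. \<forall>p \<in> P. \<not> appears_in G A p x}"
    using S by (auto simp: is_SFT_def)
  have finA: "finite A" and ne: "S \<noteq> {}"
    using S by (auto simp: is_SFT_def)
  obtain e :: "'c \<Rightarrow> nat" where e: "inj_on e A"
    using finA finite_imp_inj_to_nat_seg by metis
  define B where "B = e ` A"
  define F where "F = (\<lambda>x :: 'a \<Rightarrow> 'c. \<lambda>h \<in> carrier G. e (x h))"
  define FP where "FP = (\<lambda>p :: 'a set \<times> ('a \<Rightarrow> 'c). (fst p, \<lambda>h \<in> fst p. e (snd p h)))"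
  have F_mem: "F x \<in> full_shift G B" if "x \<in> full_shift G A" for x
    using that by (auto simp: F_def full_shift_def B_def)
  have F_inj: "x = y" if "x \<in> full_shift G A" "y \<in> full_shift G A" "F x = F y" for x y
  proof (rule full_shift_eqI[OF that(1,2)])
    fix h assume h: "h \<in> carrier G"
    have "e (x h) = e (y h)"
      using fun_cong[OF that(3), of h] h by (simp add: F_def)
    then show "x h = y h"
      using e that(1,2) h by (auto simp: full_shift_def dest: inj_onD)
  qed
  have F_surj: "\<exists>x \<in> full_shift G A. F x = y" if y: "y \<in> full_shift G B" for y
  proof -
    define x where "x = (\<lambda>h \<in> carrier G. inv_into A e (y h))"
    have yh: "y h \<in> e ` A" if "h \<in> carrier G" for h
      using y that by (auto simp: full_shift_def B_def)
    have x: "x \<in> full_shift G A"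
      using yh by (auto simp: x_def full_shift_def inv_into_into)
    have "F x = y"
      by (rule full_shift_eqI[OF F_mem[OF x] y])
         (use yh in \<open>simp add: F_def x_def f_inv_into_f\<close>)
    with x show ?thesis by blast
  qed
  have F_act: "shift_action G B g (F x) = F (shift_action G A g x)"
    if "g \<in> carrier G" "x \<in> full_shift G A" for g x
    by (rule full_shift_eqI[where A = B])
       (use that in \<open>auto simp: shift_action_closed F_mem shift_action_apply,
          auto simp: F_def shift_action_apply\<close>)
  have app: "appears_in G B (FP p) (F x) \<longleftrightarrow> appears_in G A p x"
    if p: "p \<in> patterns G A" and x: "x \<in> full_shift G A" for p x
  proof -
    obtain \<Omega> q where pq: "p = (\<Omega>, q)" and \<Omega>: "\<Omega> \<subseteq> carrier G" and q: "q \<in> \<Omega> \<rightarrow>\<^sub>E A"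
      using p by (auto simp: patterns_def)
    have "restrict (F z) \<Omega> = (\<lambda>h \<in> \<Omega>. e (q h)) \<longleftrightarrow> restrict z \<Omega> = q"
      if z: "z \<in> full_shift G A" for z
    proof -
      have "restrict (F z) \<Omega> = (\<lambda>h \<in> \<Omega>. e (q h)) \<longleftrightarrow> (\<forall>h \<in> \<Omega>. e (z h) = e (q h))"
        using \<Omega> by (auto simp: F_def restrict_def fun_eq_iff)
      also have "\<dots> \<longleftrightarrow> (\<forall>h \<in> \<Omega>. z h = q h)"
      proof (rule ball_cong[OF refl])
        fix h assume h: "h \<in> \<Omega>"
        have "z h \<in> A" "q h \<in> A"
          using z q \<Omega> h by (auto simp: full_shift_def)
        then show "e (z h) = e (q h) \<longleftrightarrow> z h = q h"
          using e by (auto dest: inj_onD)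
      qed
      also have "\<dots> \<longleftrightarrow> restrict z \<Omega> = q"
        using q by (auto simp: restrict_def fun_eq_iff PiE_def extensional_def)
      finally show ?thesis .
    qed
    then show ?thesis
      using x by (auto simp: appears_in_def pq FP_def F_act shift_action_closed)
  qed
  have "is_SFT G B (F ` S)"
    unfolding is_SFT_def
  proof (intro conjI exI)
    show "finite B" "F ` S \<noteq> {}" "finite (FP ` P)"
      using finA ne P by (auto simp: B_def)
    show "FP ` P \<subseteq> patterns G B"
    proof (rule image_subsetI)
      fix p assume "p \<in> P"
      then have "p \<in> patterns G A" using P by blast
      then show "FP p \<in> patterns G B"
        by (auto simp: patterns_def FP_def B_def dest: PiE_mem)
    qed
    show "F ` S = {y \<in> full_shift G B. \<forall>p \<in> FP ` P. \<not> appears_in G B p y}" (is "_ = ?R")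
    proof (rule Set.set_eqI)
      fix y
      show "y \<in> F ` S \<longleftrightarrow> y \<in> ?R"
      proof
        assume "y \<in> F ` S"
        then obtain x where x: "x \<in> full_shift G A" "\<forall>p \<in> P. \<not> appears_in G A p x" "y = F x"
          using S_eq by auto
        have "\<not> appears_in G B (FP p) (F x)" if "p \<in> P" for p
          using app[of p x] that P(2) x(1,2) by blast
        then show "y \<in> ?R" using x F_mem by auto
      next
        assume y: "y \<in> ?R"
        then obtain x where x: "x \<in> full_shift G A" "F x = y"
          using F_surj by blast
        have "\<not> appears_in G A p x" if "p \<in> P" for p
          using app[of p x] that P(2) x y by auto
        then show "y \<in> F ` S" using x S_eq by auto
      qed
    qed
  qed
  then obtain x where x: "x \<in> S" "strongly_periodic_config G B (F x)"
    using G by (auto simp: strongly_periodic_def)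
  have xs: "x \<in> full_shift G A"
    using x S_eq by auto
  have "shift_action G B g (F x) = F x \<longleftrightarrow> shift_action G A g x = x" if "g \<in> carrier G" for g
    using F_inj[OF shift_action_closed[OF that xs] xs] F_act[OF that xs] by auto
  then have "stabilizer G (shift_action G B) (F x) = stabilizer G (shift_action G A) x"
    by (auto simp: stabilizer_def)
  with x show ?thesis
    by (auto simp: strongly_periodic_config_def)
qed

end

end

theory Submission
  imports Defs
begin

text \<open>
  Pulling back along \<open>\<pi>\<close> identifies the configurations over \<open>Q\<close> with the configurations over \<open>G\<close>
  that are constant on the cosets of the kernel. As the kernel is generated by a finite set \<open>T\<close>,
  this is a local condition: it suffices to forbid the patterns on \<open>{\<one>, t}\<close>, \<open>t \<in> T\<close>,
  taking two different values. So the pullback of an SFT over \<open>Q\<close> is an SFT over \<open>G\<close>, and the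
  stabilizer of a configuration over \<open>Q\<close> is the image of the stabilizer of its pullback,
  hence inherits finite index.
\<close>

section \<open>Pulling configurations back along an epimorphism\<close>

locale group_epi = group_hom +
  assumes surj: "h ` carrier G = carrier H"
begin

text \<open>Taking images sends the right coset of \<open>K\<close> through \<open>a\<close> to the
  right coset of the image through \<open>h a\<close>; as \<open>h\<close> is onto, every coset
  downstairs arises this way.\<close>

lemma finite_rcosets_image:
  assumes K: "K \<subseteq> carrier G" and fin: "finite (rcosets\<^bsub>G\<^esub> K)"
  shows "finite (rcosets\<^bsub>H\<^esub> (h ` K))"
proof -
  have "(h ` K) #>\<^bsub>H\<^esub> h a = h ` (K #>\<^bsub>G\<^esub> a)" if "a \<in> carrier G" for a
    using K that by (force simp: r_coset_def)
  then have "rcosets\<^bsub>H\<^esub> (h ` K) = (`) h ` (rcosets\<^bsub>G\<^esub> K)"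
    by (auto simp: RCOSETS_def image_iff simp flip: surj)
  with fin show ?thesis
    by simp
qed

text \<open>\<open>compose\<close> makes the result \<open>undefined\<close> off
  \<open>carrier G\<close>, as \<open>full_shift\<close> demands.\<close>

definition pullback :: "('c \<Rightarrow> 'e) \<Rightarrow> 'a \<Rightarrow> 'e" where
  "pullback y = compose (carrier G) y h"

lemma pullback_apply: "g \<in> carrier G \<Longrightarrow> pullback y g = y (h g)"
  by (simp add: pullback_def compose_eq)

lemma pullback_closed:
  "y \<in> full_shift H A \<Longrightarrow> pullback y \<in> full_shift G A"
  by (auto simp: full_shift_def pullback_def compose_def)

lemma pullback_inject:
  assumes "y \<in> full_shift H A" "z \<in> full_shift H A" "pullback y = pullback z"
  shows "y = z"
proof (rule H.full_shift_eqI[OF assms(1,2)])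
  fix q assume "q \<in> carrier H"
  then obtain g where "g \<in> carrier G" "q = h g"
    using surj by blast
  then show "y q = z q"
    using assms(3) by (metis pullback_apply)
qed

lemma shift_action_pullback:
  assumes "g \<in> carrier G" "y \<in> full_shift H A"
  shows "shift_action G A g (pullback y) = pullback (shift_action H A (h g) y)"
  by (rule G.full_shift_eqI[where A = A])
     (use assms in \<open>simp_all add: G.shift_action_closed H.shift_action_closed pullback_closed
        G.shift_action_apply H.shift_action_apply pullback_apply\<close>)

text \<open>Equivariance and injectivity of \<open>pullback\<close> show that \<open>g\<close> fixes
  \<open>pullback y\<close> exactly when \<open>h g\<close> fixes \<open>y\<close>; every element of
  \<open>H\<close> is such an \<open>h g\<close>.\<close>

lemma stabilizer_pullback:
  assumes "y \<in> full_shift H A"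
  shows "stabilizer H (shift_action H A) y = h ` stabilizer G (shift_action G A) (pullback y)"
proof -
  have "shift_action G A g (pullback y) = pullback y \<longleftrightarrow> shift_action H A (h g) y = y"
    if "g \<in> carrier G" for g
    using that assms by (metis shift_action_pullback pullback_inject H.shift_action_closed hom_closed)
  then show ?thesis
    by (auto simp: stabilizer_def image_iff simp flip: surj)
qed

lemma strongly_periodic_config_pullback:
  assumes "y \<in> full_shift H A" "strongly_periodic_config G A (pullback y)"
  shows "strongly_periodic_config H A y"
proof -
  have "stabilizer G (shift_action G A) (pullback y) \<subseteq> carrier G"
    by (auto simp: stabilizer_def)
  with assms show ?thesis
    by (simp add: strongly_periodic_config_def stabilizer_pullback finite_rcosets_image)
qed

text \<open>One chosen preimage per point keeps the support finite; the full preimage would be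
  infinite for a nonempty support and an infinite kernel.\<close>

definition lift_pattern :: "'c set \<times> ('c \<Rightarrow> 'e) \<Rightarrow> 'a set \<times> ('a \<Rightarrow> 'e)" where
  "lift_pattern p =
     (let \<Omega> = inv_into (carrier G) h ` fst p in (\<Omega>, \<lambda>g \<in> \<Omega>. snd p (h g)))"

lemma h_inv_into: "q \<in> carrier H \<Longrightarrow> h (inv_into (carrier G) h q) = q"
  by (simp add: f_inv_into_f surj)

lemma inv_into_closed: "q \<in> carrier H \<Longrightarrow> inv_into (carrier G) h q \<in> carrier G"
  by (simp add: inv_into_into surj)

lemma lift_pattern_closed:
  assumes "p \<in> patterns H A"
  shows "lift_pattern p \<in> patterns G A"
proof -
  have "h (inv_into (carrier G) h q) = q" "inv_into (carrier G) h q \<in> carrier G" if "q \<in> fst p" for q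
    using that assms by (auto simp: patterns_def h_inv_into inv_into_closed)
  with assms show ?thesis
    by (auto simp: patterns_def lift_pattern_def)
qed

text \<open>Translating \<open>pullback y\<close> by \<open>g\<close> pulls back the translate of
  \<open>y\<close> by \<open>h g\<close>, and on the chosen preimages it shows the same values. By
  surjectivity all translates of \<open>y\<close> are tested.\<close>

lemma appears_in_pullback:
  assumes p: "p \<in> patterns H A" and y: "y \<in> full_shift H A"
  shows "appears_in G A (lift_pattern p) (pullback y) \<longleftrightarrow> appears_in H A p y"
proof -
  obtain \<Omega> f where pf: "p = (\<Omega>, f)" and \<Omega>: "\<Omega> \<subseteq> carrier H" and f: "f \<in> \<Omega> \<rightarrow>\<^sub>E A"
    using p by (auto simp: patterns_def)
  let ?s = "inv_into (carrier G) h"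
  have s: "?s q \<in> carrier G" "h (?s q) = q" if "q \<in> \<Omega>" for q
    using that \<Omega> by (auto simp: h_inv_into inv_into_closed)
  have "restrict (pullback z) (fst (lift_pattern p)) = snd (lift_pattern p)
      \<longleftrightarrow> restrict z \<Omega> = f" for z
  proof -
    have "restrict (pullback z) (fst (lift_pattern p)) = snd (lift_pattern p)
        \<longleftrightarrow> (\<forall>q \<in> \<Omega>. z q = f q)"
      using s by (auto simp: pf lift_pattern_def restrict_def fun_eq_iff pullback_apply)
    also have "\<dots> \<longleftrightarrow> restrict z \<Omega> = f"
      using f by (auto simp: restrict_def fun_eq_iff PiE_def extensional_def)
    finally show ?thesis .
  qed
  then show ?thesis
    using y by (auto simp: appears_in_def pf shift_action_pullback simp flip: surj)
qed

text \<open>Such an \<open>x\<close> descends to the quotient: \<open>y\<close> reads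
  \<open>x\<close> at a chosen preimage, and invariance under the kernel makes the choice
  irrelevant.\<close>

lemma mem_range_pullback:
  assumes x: "x \<in> full_shift G A"
    and inv: "\<And>g k. g \<in> carrier G \<Longrightarrow> k \<in> kernel G H h \<Longrightarrow> x (g \<otimes> k) = x g"
  obtains y where "y \<in> full_shift H A" "pullback y = x"
proof
  let ?s = "inv_into (carrier G) h"
  define y where "y = (\<lambda>q \<in> carrier H. x (?s q))"
  show y: "y \<in> full_shift H A"
    using x by (auto simp: y_def full_shift_def inv_into_closed)
  show "pullback y = x"
  proof (rule G.full_shift_eqI[OF pullback_closed[OF y] x])
    fix g assume g: "g \<in> carrier G"
    have sg: "?s (h g) \<in> carrier G" "h (?s (h g)) = h g"
      using g by (simp_all add: h_inv_into inv_into_closed)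
    \<comment> \<open>The chosen preimage of \<open>h g\<close> is \<open>g\<close> times a kernel
      element on the right.\<close>
    have "inv g \<otimes> ?s (h g) \<in> kernel G H h"
      using g sg by (simp add: kernel_def)
    from inv[OF g this] have "x (?s (h g)) = x g"
      using g sg by (simp flip: G.m_assoc)
    then show "pullback y g = x g"
      using g by (simp add: pullback_apply y_def)
  qed
qed

end

section \<open>Local patterns forcing invariance under a finitely generated subgroup\<close>

definition (in group) edge_patterns :: "'e set \<Rightarrow> 'a set \<Rightarrow> ('a set \<times> ('a \<Rightarrow> 'e)) set" where
  "edge_patterns A T =
     (SIGMA \<Omega>:(\<lambda>t. {\<one>, t}) ` T. {f \<in> \<Omega> \<rightarrow>\<^sub>E A. \<exists>t \<in> \<Omega>. f t \<noteq> f \<one>})"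

context group
begin

lemma finite_edge_patterns: "finite A \<Longrightarrow> finite T \<Longrightarrow> finite (edge_patterns A T)"
  by (auto simp: edge_patterns_def intro!: finite_SigmaI finite_PiE)

lemma edge_patterns_closed: "T \<subseteq> carrier G \<Longrightarrow> edge_patterns A T \<subseteq> patterns G A"
  by (auto simp: edge_patterns_def patterns_def)

lemma edge_pattern_appears_iff:
  assumes T: "T \<subseteq> carrier G" and x: "x \<in> full_shift G A"
  shows "(\<exists>p \<in> edge_patterns A T. appears_in G A p x) \<longleftrightarrow>
    (\<exists>g \<in> carrier G. \<exists>t \<in> T. x (g \<otimes> t) \<noteq> x g)"
proof
  assume "\<exists>p \<in> edge_patterns A T. appears_in G A p x"
  then obtain t f g where *: "t \<in> T" "f t \<noteq> f \<one>" "g \<in> carrier G"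
      "restrict (shift_action G A g x) {\<one>, t} = f"
    by (auto simp: edge_patterns_def appears_in_def)
  then have "shift_action G A g x t \<noteq> shift_action G A g x \<one>"
    by auto
  then have "x (inv g \<otimes> t) \<noteq> x (inv g)"
    using * T x by (auto simp: shift_action_apply)
  then show "\<exists>g \<in> carrier G. \<exists>t \<in> T. x (g \<otimes> t) \<noteq> x g"
    using * by blast
next
  assume "\<exists>g \<in> carrier G. \<exists>t \<in> T. x (g \<otimes> t) \<noteq> x g"
  then obtain g t where *: "g \<in> carrier G" "t \<in> T" "x (g \<otimes> t) \<noteq> x g"
    by blast
  \<comment> \<open>The action evaluates at inverse translates, so shifting by \<open>inv g\<close>
    moves the edge from \<open>g\<close> to \<open>g \<otimes> t\<close> onto the edge from
    \<open>\<one>\<close> to \<open>t\<close>.\<close>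
  define z where "z = shift_action G A (inv g) x"
  have z: "z \<in> full_shift G A" "z t \<noteq> z \<one>"
    using * T x by (auto simp: z_def shift_action_closed shift_action_apply)
  have "({\<one>, t}, restrict z {\<one>, t}) \<in> edge_patterns A T"
    using * T z by (auto simp: edge_patterns_def full_shift_def)
  moreover have "appears_in G A ({\<one>, t}, restrict z {\<one>, t}) x"
    using * by (auto simp: appears_in_def z_def intro!: bexI[of _ "inv g"])
  ultimately show "\<exists>p \<in> edge_patterns A T. appears_in G A p x"
    by blast
qed

text \<open>Induction on the word \<open>k\<close>, with the base point \<open>g\<close> arbitrary
  because a product is absorbed one factor at a time from different base points.\<close>

lemma right_invariant_generate:
  assumes T: "T \<subseteq> carrier G"
    and inv: "\<And>g t. g \<in> carrier G \<Longrightarrow> t \<in> T \<Longrightarrow> x (g \<otimes> t) = x g"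
    and k: "k \<in> generate G T" and g: "g \<in> carrier G"
  shows "x (g \<otimes> k) = x g"
  using k g
proof (induction arbitrary: g)
  \<comment> \<open>From the base point \<open>g \<otimes> inv t\<close>, a step by \<open>t\<close>
    leads back to \<open>g\<close>.\<close>
  case (inv t)
  then show ?case
    using T assms(2)[of "g \<otimes> inv t" t] by (auto simp: m_assoc)
next
  case (eng k l)
  then show ?case
    using generate_in_carrier[OF T] by (simp flip: m_assoc)
qed (use inv in auto)

end

section \<open>Transfer of SFTs and of strong periodicity\<close>

context group_epi
begin

lemma is_SFT_pullback:
  assumes T: "finite T" "T \<subseteq> carrier G" "generate G T = kernel G H h"
    and S: "is_SFT H A S"
  shows "is_SFT G A (pullback ` S)"
proof -
  obtain P where P: "finite P" "P \<subseteq> patterns H A"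
      and S_eq: "S = {y \<in> full_shift H A. \<forall>p \<in> P. \<not> appears_in H A p y}"
    using S by (auto simp: is_SFT_def)
  have A: "finite A" "S \<noteq> {}"
    using S by (auto simp: is_SFT_def)
  \<comment> \<open>The edge patterns cut out the pullbacks among all configurations over
    \<open>G\<close>; the lifted patterns then impose the rules of \<open>S\<close>.\<close>
  let ?P = "lift_pattern ` P \<union> G.edge_patterns A T"
  have lift: "(\<forall>p \<in> lift_pattern ` P. \<not> appears_in G A p (pullback y)) \<longleftrightarrow> y \<in> S"
    if "y \<in> full_shift H A" for y
    using that P by (auto simp: S_eq appears_in_pullback subset_iff)
  have "pullback ` S = {x \<in> full_shift G A. \<forall>p \<in> ?P. \<not> appears_in G A p x}" (is "_ = ?R")
  proof (intro subset_antisym subsetI)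
    fix x assume "x \<in> pullback ` S"
    then obtain y where y: "y \<in> S" "y \<in> full_shift H A" "x = pullback y"
      by (auto simp: S_eq)
    have "h t = \<one>\<^bsub>H\<^esub>" if "t \<in> T" for t
      using generate.incl[OF that, of G] T(3) by (simp add: kernel_def)
    then have "x (g \<otimes> t) = x g" if "g \<in> carrier G" "t \<in> T" for g t
      using that T(2) by (auto simp: y pullback_apply subset_iff)
    then show "x \<in> ?R"
      using y lift[of y] G.edge_pattern_appears_iff[OF T(2), of x A] pullback_closed[of y A]
      by blast
  next
    fix x assume x: "x \<in> ?R"
    then have "x (g \<otimes> t) = x g" if "g \<in> carrier G" "t \<in> T" for g t
      using that G.edge_pattern_appears_iff[OF T(2), of x A] by blast
    \<comment> \<open>Invariance passes from the generators to the whole kernel, so \<open>x\<close>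
      descends to \<open>H\<close>.\<close>
    then have "x (g \<otimes> k) = x g" if "g \<in> carrier G" "k \<in> kernel G H h" for g k
      using that T G.right_invariant_generate by metis
    then obtain y where y: "y \<in> full_shift H A" "pullback y = x"
      using x mem_range_pullback by blast
    then show "x \<in> pullback ` S"
      using x lift[of y] by blast
  qed
  moreover have "finite ?P"
    using P T A by (simp add: G.finite_edge_patterns)
  moreover have "?P \<subseteq> patterns G A"
    using P(2) G.edge_patterns_closed[OF T(2)] lift_pattern_closed
    by (intro Un_least image_subsetI) blast+
  ultimately show ?thesis
    using A unfolding is_SFT_def by blast
qed

lemma strongly_periodic_image:
  assumes T: "finite T" "T \<subseteq> carrier G" "generate G T = kernel G H h"
    and G: "strongly_periodic G"
  shows "strongly_periodic H"
  unfolding strongly_periodic_def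
proof (intro allI impI)
  fix A :: "nat set" and S
  assume S: "is_SFT H A S"
  \<comment> \<open>The pulled back SFT has the same alphabet of naturals, so the hypothesis on
    \<open>G\<close> applies directly.\<close>
  then obtain y where y: "y \<in> S" "strongly_periodic_config G A (pullback y)"
    using G is_SFT_pullback[OF T] unfolding strongly_periodic_def by blast
  then have "strongly_periodic_config H A y"
    using S by (auto simp: is_SFT_def intro: strongly_periodic_config_pullback)
  with y show "\<exists>y \<in> S. strongly_periodic_config H A y"
    by blast
qed

end

theorem theorem3:
  fixes N :: "('n, 'k) monoid_scheme"
    and G :: "('g, 'l) monoid_scheme"
    and Q :: "('q, 'm) monoid_scheme"
    and \<iota> :: "'n \<Rightarrow> 'g"
    and \<pi> :: "'g \<Rightarrow> 'q"
  assumes "group N" and "group G" and "group Q"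
    and "\<iota> \<in> mon N G"
    and "\<pi> \<in> epi G Q"
    and "kernel G Q \<pi> = \<iota> ` carrier N"
    and "finitely_generated_group N"
    and "strongly_periodic G"
  shows "strongly_periodic Q"
proof -
  interpret \<iota>: group_hom N G \<iota>
    using assms by (simp add: group_hom_def group_hom_axioms_def mon_def)
  interpret \<pi>: group_epi G Q \<pi>
    using assms
    by (simp add: group_epi_def group_epi_axioms_def group_hom_def group_hom_axioms_def epi_def)
  obtain T where T: "finite T" "T \<subseteq> carrier N" "generate N T = carrier N"
    using assms(7) by (auto simp: finitely_generated_group_def)
  show ?thesis
  proof (rule \<pi>.strongly_periodic_image)
    show "finite (\<iota> ` T)" "\<iota> ` T \<subseteq> carrier G"
      using T by auto
    \<comment> \<open>A homomorphism carries generators of \<open>N\<close> to generators of its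
      image, which is the kernel by exactness.\<close>
    show "generate G (\<iota> ` T) = kernel G Q \<pi>"
      using \<iota>.generate_img[OF T(2)] T(3) assms(6) by simp
  qed (fact assms(8))
qed

end
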